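(* The unconditional constant of the canonical basis of $\mathcal{P}\left(^2D\left(\frac{\pi}{4}\right)\right)$ is $5+4\sqrt{2}$. In other words, the inequality $$ \||P|\|_{D\left(\frac{\pi}{4}\right)}\leq (5+4\sqrt{2})\,\|P\|_{D\left(\frac{\pi}{4}\right)} $$ holds for all $P\in\mathcal{P}\left(^2D\left(\frac{\pi}{4}\right)\right)$. Furthermore, this inequality is sharp, and equality is attained for the polynomials $\pm\left[x^2+(5+4\sqrt{2})y^2-(4+4\sqrt{2})xy\right]$.
   Context: $D\left(\frac{\pi}{4}\right):=\left\{e^{i\theta}:\theta\in\left[0,\frac{\pi}{4}\right]\right\}$, viewed as a subset of $\mathbb{R}^2$ (i.e. the points $(\cos\theta,\sin\theta)$ with $0\le\theta\le\pi/4$). $\mathcal{P}\left(^2D\left(\frac{\pi}{4}\right)\right)$ is the space of real $2$-homogeneous polynomials $P(x,y)=ax^2+by^2+cxy$ on $\mathbb{R}^2$ ($a,b,c\in\mathbb{R}$) endowed with the norm $\|P\|_{D\left(\frac{\pi}{4}\right)}=\sup\left\{|P(x,y)|:(x,y)\in D\left(\frac{\pi}{4}\right)\right\}$. The modulus of $P(x,y)=ax^2+by^2+cxy$ is the polynomial $|P|(x,y)=|a|x^2+|b|y^2+|c|xy$. The canonical basis consists of the monomials $x^2,y^2,xy$, and its unconditional constant is the smallest constant $C>0$ such that $\||P|\|_{D\left(\frac{\pi}{4}\right)}\leq C\|P\|_{D\left(\frac{\pi}{4}\right)}$ for all $P\in\mathcal{P}\left(^2D\left(\frac{\pi}{4}\right)\right)$.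 *)

theory Defs
  imports Complex_Main
begin

definition arc :: "real \<Rightarrow> (real \<times> real) set" where
  "arc \<beta> = {(cos \<theta>, sin \<theta>) | \<theta>. 0 \<le> \<theta> \<and> \<theta> \<le> \<beta>}"

definition hpoly :: "real \<Rightarrow> real \<Rightarrow> real \<Rightarrow> real \<times> real \<Rightarrow> real" where
  "hpoly a b c = (\<lambda>(x, y). a * x\<^sup>2 + b * y\<^sup>2 + c * x * y)"

definition hpolys :: "(real \<times> real \<Rightarrow> real) set" where
  "hpolys = {hpoly a b c | a b c. True}"

text \<open>On a bounded set such as an arc, the values of a polynomial are bounded, so the
  supremum below is a genuine one.\<close>

definition sup_norm :: "(real \<times> real) set \<Rightarrow> (real \<times> real \<Rightarrow> real) \<Rightarrow> real" where
  "sup_norm D P = (SUP z\<in>D. \<bar>P z\<bar>)"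

text \<open>Polynomials are represented as functions; the modulus is well defined on
  \<^const>\<open>hpolys\<close> because a 2-homogeneous polynomial function determines its coefficients
  (see \<open>hpoly_inject\<close> and \<open>modulus_hpoly\<close>).\<close>

definition modulus :: "(real \<times> real \<Rightarrow> real) \<Rightarrow> (real \<times> real \<Rightarrow> real)" where
  "modulus P = (THE Q. \<exists>a b c. P = hpoly a b c \<and> Q = hpoly \<bar>a\<bar> \<bar>b\<bar> \<bar>c\<bar>)"

lemma hpoly_inject: "hpoly a b c = hpoly a' b' c' \<longleftrightarrow> a = a' \<and> b = b' \<and> c = c'"
proof
  assume eq: "hpoly a b c = hpoly a' b' c'"
  have "a = a'" using fun_cong[OF eq, of "(1, 0)"] by (simp add: hpoly_def)
  moreover have "b = b'" using fun_cong[OF eq, of "(0, 1)"] by (simp add: hpoly_def)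
  ultimately show "a = a' \<and> b = b' \<and> c = c'"
    using fun_cong[OF eq, of "(1, 1)"] by (simp add: hpoly_def)
qed simp

lemma modulus_hpoly: "modulus (hpoly a b c) = hpoly \<bar>a\<bar> \<bar>b\<bar> \<bar>c\<bar>"
  unfolding modulus_def by (rule the_equality) (auto simp: hpoly_inject)

definition unconditional_bound :: "(real \<times> real) set \<Rightarrow> real \<Rightarrow> bool" where
  "unconditional_bound D C \<longleftrightarrow>
     C > 0 \<and> (\<forall>P\<in>hpolys. sup_norm D (modulus P) \<le> C * sup_norm D P)"

text \<open>A predicate, rather than an infimum, so that it includes the existence of a smallest
  constant.\<close>

definition is_unconditional_constant :: "(real \<times> real) set \<Rightarrow> real \<Rightarrow> bool" where
  "is_unconditional_constant D C \<longleftrightarrow>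
     unconditional_bound D C \<and> (\<forall>C'. unconditional_bound D C' \<longrightarrow> C \<le> C')"

end

theory Submission
  imports Defs
begin

text \<open>On the unit circle, \<open>a x\<^sup>2 + b y\<^sup>2 + c x y\<close> is a trigonometric polynomial of degree at most one in
  \<open>\<phi> = 2\<theta>\<close>, and the sector becomes \<open>0 \<le> \<phi> \<le> \<pi>/2\<close>. Three values determine such a function,
  and the right three are at the ends and the midpoint, \<open>\<theta> = 0, \<pi>/8, \<pi>/4\<close>: there the extremal
  polynomial \<open>x\<^sup>2 + (5 + 4\<surd>2) y\<^sup>2 - (4 + 4\<surd>2) x y\<close> takes the values \<open>1, -1, 1\<close>, as a Chebyshev
  polynomial does.

  Solving for the coefficients in terms of these three values bounds \<open>\<bar>a\<bar>\<close>, \<open>\<bar>b\<bar>\<close>, \<open>\<bar>c\<bar>\<close> by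
  \<open>1\<close>, \<open>5 + 4\<surd>2\<close>, \<open>4 + 4\<surd>2\<close> times the norm (\<open>coefficient_bounds\<close>). All three bounds are attained
  by the one extremal polynomial, so nothing is lost in combining them into a bound on the
  modulus. On the sector \<open>0 \<le> y \<le> x\<close> that bound, \<open>x\<^sup>2 + (5 + 4\<surd>2) y\<^sup>2 + (4 + 4\<surd>2) x y\<close>, is at
  most \<open>5 + 4\<surd>2\<close>, with equality at \<open>\<theta> = \<pi>/4\<close>. Sharpness then needs only that the extremal
  polynomial has norm one (\<open>abs_extremal_le_1\<close>).\<close>

lemma arc_quarter_pi_subset:
  assumes "(x, y) \<in> arc (pi / 4)"
  shows "x\<^sup>2 + y\<^sup>2 = 1" "0 \<le> y" "y \<le> x"
proof -
  obtain t where t: "x = cos t" "y = sin t" "0 \<le> t" "t \<le> pi / 4"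
    using assms by (auto simp: arc_def)
  show "x\<^sup>2 + y\<^sup>2 = 1" using t by simp
  show "0 \<le> y" using t by (auto intro!: sin_ge_zero)
  have "sin t \<le> sin (pi / 4)"
    using t by (intro sin_monotone_2pi_le) auto
  also have "\<dots> = cos (pi / 4)" by (simp add: sin_45 cos_45)
  also have "\<dots> \<le> cos t"
    using t by (intro cos_monotone_0_pi_le) auto
  finally show "y \<le> x" using t by simp
qed

lemma arc_quarter_pi_points:
  "(1, 0) \<in> arc (pi / 4)"
  "(cos (pi / 8), sin (pi / 8)) \<in> arc (pi / 4)"
  "(sqrt 2 / 2, sqrt 2 / 2) \<in> arc (pi / 4)"
proof -
  have "(cos 0, sin 0) \<in> arc (pi / 4)"
    unfolding arc_def by fastforce
  then show "(1, 0) \<in> arc (pi / 4)" by simp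
  have "0 \<le> pi / 8" "pi / 8 \<le> pi / 4" by simp_all
  then show "(cos (pi / 8), sin (pi / 8)) \<in> arc (pi / 4)"
    unfolding arc_def by blast
  have "0 \<le> pi / 4" "pi / 4 \<le> pi / 4" by simp_all
  then have "(cos (pi / 4), sin (pi / 4)) \<in> arc (pi / 4)"
    unfolding arc_def by blast
  then show "(sqrt 2 / 2, sqrt 2 / 2) \<in> arc (pi / 4)" by (simp add: sin_45 cos_45)
qed

lemma sup_norm_le:
  assumes "D \<noteq> {}" "\<And>z. z \<in> D \<Longrightarrow> \<bar>P z\<bar> \<le> M"
  shows "sup_norm D P \<le> M"
  unfolding sup_norm_def using assms by (rule cSUP_least)

lemma abs_hpoly_le_sup_norm:
  assumes "z \<in> arc \<beta>"
  shows "\<bar>hpoly a b c z\<bar> \<le> sup_norm (arc \<beta>) (hpoly a b c)"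
proof -
  have "\<bar>hpoly a b c w\<bar> \<le> \<bar>a\<bar> + \<bar>b\<bar> + \<bar>c\<bar>" if "w \<in> arc \<beta>" for w
  proof -
    obtain t where w: "w = (cos t, sin t)" using \<open>w \<in> arc \<beta>\<close> by (auto simp: arc_def)
    have "\<bar>a * (cos t)\<^sup>2\<bar> \<le> \<bar>a\<bar>" "\<bar>b * (sin t)\<^sup>2\<bar> \<le> \<bar>b\<bar>" "\<bar>c * (cos t * sin t)\<bar> \<le> \<bar>c\<bar>"
      unfolding abs_mult power2_eq_square
      by (intro mult_left_le mult_le_one abs_cos_le_one abs_sin_le_one; simp)+
    then show ?thesis unfolding w hpoly_def by (simp only: prod.case mult.assoc) linarith
  qed
  then have "bdd_above ((\<lambda>z. \<bar>hpoly a b c z\<bar>) ` arc \<beta>)"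
    by (intro bdd_aboveI2[where M = "\<bar>a\<bar> + \<bar>b\<bar> + \<bar>c\<bar>"])
  then show ?thesis
    unfolding sup_norm_def using assms by (intro cSUP_upper)
qed

lemma hpoly_pi_div_8:
  "hpoly a b c (cos (pi / 8), sin (pi / 8)) = ((2 + sqrt 2) * a + (2 - sqrt 2) * b + sqrt 2 * c) / 4"
proof -
  define u v where "u = cos (pi / 8)" and "v = sin (pi / 8)"
  have "cos (2 * (pi / 8)) = sqrt 2 / 2" "sin (2 * (pi / 8)) = sqrt 2 / 2"
    by (simp_all add: cos_45 sin_45)
  then have double: "u\<^sup>2 - v\<^sup>2 = sqrt 2 / 2" "2 * v * u = sqrt 2 / 2"
    unfolding cos_double sin_double u_def v_def .
  have "v\<^sup>2 + u\<^sup>2 = 1" by (simp add: u_def v_def)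
  then have "u\<^sup>2 = (2 + sqrt 2) / 4" "v\<^sup>2 = (2 - sqrt 2) / 4"
    using double(1) by (simp_all add: field_simps)
  moreover have "u * v = sqrt 2 / 4" using double(2) by (simp add: mult.commute)
  moreover have "hpoly a b c (u, v) = a * u\<^sup>2 + b * v\<^sup>2 + c * (u * v)"
    by (simp add: hpoly_def)
  ultimately have "hpoly a b c (u, v) = ((2 + sqrt 2) * a + (2 - sqrt 2) * b + sqrt 2 * c) / 4"
    by (simp only:) (simp add: field_simps)
  then show ?thesis unfolding u_def v_def .
qed

text \<open>The factors \<open>5 + 4\<surd>2\<close> and \<open>4 + 4\<surd>2\<close> are the sums of the absolute values of the weights with
  which the three interpolated values enter \<open>b\<close> and \<open>c\<close>. The weights have sign pattern \<open>+, -, +\<close>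
  for \<open>b\<close> and \<open>-, +, -\<close> for \<open>c\<close>, which is why values \<open>1, -1, 1\<close> make both bounds equalities.\<close>

lemma coefficient_bounds:
  defines "N \<equiv> \<lambda>a b c. sup_norm (arc (pi / 4)) (hpoly a b c)"
  shows "\<bar>a\<bar> \<le> N a b c" "\<bar>b\<bar> \<le> (5 + 4 * sqrt 2) * N a b c" "\<bar>c\<bar> \<le> (4 + 4 * sqrt 2) * N a b c"
proof -
  define s p q r where "s = sqrt 2" and "p = a"
    and "q = ((2 + s) * a + (2 - s) * b + s * c) / 4" and "r = (a + b + c) / 2"
  have s: "s * s = 2" "0 \<le> s" by (simp_all add: s_def)
  have ss: "s * (s * x) = 2 * x" for x using s(1) by (simp flip: mult.assoc)
  have p: "\<bar>p\<bar> \<le> N a b c"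
    using abs_hpoly_le_sup_norm[OF arc_quarter_pi_points(1), of a b c]
    by (simp add: hpoly_def p_def N_def)
  have q: "\<bar>q\<bar> \<le> N a b c"
    using abs_hpoly_le_sup_norm[OF arc_quarter_pi_points(2), of a b c]
    unfolding hpoly_pi_div_8 q_def N_def s_def .
  have "hpoly a b c (sqrt 2 / 2, sqrt 2 / 2) = r"
    by (simp add: hpoly_def r_def power2_eq_square field_simps)
  then have r: "\<bar>r\<bar> \<le> N a b c"
    using abs_hpoly_le_sup_norm[OF arc_quarter_pi_points(3), of a b c] by (simp add: N_def)
  have combine: "\<bar>u * p + v * q + w * r\<bar> \<le> (\<bar>u\<bar> + \<bar>v\<bar> + \<bar>w\<bar>) * N a b c" for u v w
  proof -
    have "\<bar>u * p + v * q + w * r\<bar> \<le> \<bar>u\<bar> * \<bar>p\<bar> + \<bar>v\<bar> * \<bar>q\<bar> + \<bar>w\<bar> * \<bar>r\<bar>"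
      unfolding abs_mult[symmetric] by linarith
    also have "\<dots> \<le> \<bar>u\<bar> * N a b c + \<bar>v\<bar> * N a b c + \<bar>w\<bar> * N a b c"
      using p q r by (intro add_mono mult_left_mono) auto
    finally show ?thesis by (simp add: distrib_right)
  qed
  have b: "b = (1 + s) * p + (- 2 - 2 * s) * q + (2 + s) * r"
    unfolding p_def q_def r_def by (simp add: field_simps s ss)
  have c: "c = (- 2 - s) * p + (2 + 2 * s) * q + (- s) * r"
    unfolding p_def q_def r_def by (simp add: field_simps s ss)
  show "\<bar>a\<bar> \<le> N a b c" using p by (simp add: p_def)
  have "\<bar>1 + s\<bar> + \<bar>- 2 - 2 * s\<bar> + \<bar>2 + s\<bar> = 5 + 4 * s"
    "\<bar>- 2 - s\<bar> + \<bar>2 + 2 * s\<bar> + \<bar>- s\<bar> = 4 + 4 * s"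
    using s(2) by simp_all
  then show "\<bar>b\<bar> \<le> (5 + 4 * sqrt 2) * N a b c" "\<bar>c\<bar> \<le> (4 + 4 * sqrt 2) * N a b c"
    using combine[of "1 + s" "- 2 - 2 * s" "2 + s"] combine[of "- 2 - s" "2 + 2 * s" "- s"]
    unfolding b[symmetric] c[symmetric] s_def[symmetric] by (simp_all only:)
qed

lemma sup_norm_modulus_le:
  assumes "P \<in> hpolys"
  shows "sup_norm (arc (pi / 4)) (modulus P) \<le> (5 + 4 * sqrt 2) * sup_norm (arc (pi / 4)) P"
proof -
  obtain a b c where P: "P = hpoly a b c" using assms by (auto simp: hpolys_def)
  define N where "N = sup_norm (arc (pi / 4)) P"
  note coeff = coefficient_bounds[where a = a and b = b and c = c, folded P, folded N_def]
  have N: "0 \<le> N" using coeff(1) by linarith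
  have "\<bar>hpoly \<bar>a\<bar> \<bar>b\<bar> \<bar>c\<bar> (x, y)\<bar> \<le> (5 + 4 * sqrt 2) * N" if "(x, y) \<in> arc (pi / 4)" for x y
  proof -
    note xy = arc_quarter_pi_subset[OF that]
    have "\<bar>hpoly \<bar>a\<bar> \<bar>b\<bar> \<bar>c\<bar> (x, y)\<bar> = \<bar>a\<bar> * x\<^sup>2 + \<bar>b\<bar> * y\<^sup>2 + \<bar>c\<bar> * (x * y)"
      using xy by (simp add: hpoly_def mult.assoc)
    also have "\<dots> \<le> N * x\<^sup>2 + (5 + 4 * sqrt 2) * N * y\<^sup>2 + (4 + 4 * sqrt 2) * N * (x * y)"
      using coeff xy by (intro add_mono mult_right_mono) auto
    \<comment> \<open>The slack is a nonnegative multiple of \<open>x\<^sup>2 - x y\<close>, and the sector lies below the diagonal.\<close>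
    also have "\<dots> = N * ((5 + 4 * sqrt 2) * (x\<^sup>2 + y\<^sup>2) - (4 + 4 * sqrt 2) * (x * (x - y)))"
      by (simp add: algebra_simps power2_eq_square)
    also have "\<dots> \<le> N * ((5 + 4 * sqrt 2) * (x\<^sup>2 + y\<^sup>2))"
      using N xy by (intro mult_left_mono) auto
    finally show ?thesis using xy by (simp add: mult.commute)
  qed
  then have "sup_norm (arc (pi / 4)) (hpoly \<bar>a\<bar> \<bar>b\<bar> \<bar>c\<bar>) \<le> (5 + 4 * sqrt 2) * N"
    using arc_quarter_pi_points(1) by (intro sup_norm_le) auto
  then show ?thesis by (simp add: P modulus_hpoly N_def)
qed

text \<open>Both one-sided bounds come from comparison with \<open>x\<^sup>2 + y\<^sup>2 = 1\<close>: the difference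
  \<open>1 - P\<close> equals \<open>(4 + 4\<surd>2) y (x - y)\<close>, vanishing at the two end points, and \<open>1 + P\<close> is the square
  of a linear form, vanishing in the direction \<open>\<theta> = \<pi>/8\<close>.\<close>

lemma abs_extremal_le_1:
  assumes "(x, y) \<in> arc (pi / 4)"
  shows "\<bar>hpoly 1 (5 + 4 * sqrt 2) (- (4 + 4 * sqrt 2)) (x, y)\<bar> \<le> 1"
proof -
  note xy = arc_quarter_pi_subset[OF assms]
  define P where "P = hpoly 1 (5 + 4 * sqrt 2) (- (4 + 4 * sqrt 2)) (x, y)"
  have "(x\<^sup>2 + y\<^sup>2) - P = (4 + 4 * sqrt 2) * (y * (x - y))"
    by (simp add: P_def hpoly_def algebra_simps power2_eq_square)
  moreover have "(4 + 4 * sqrt 2) * (y * (x - y)) \<ge> 0" using xy by simp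
  moreover have "(x\<^sup>2 + y\<^sup>2) + P = (sqrt 2 * x - (2 + sqrt 2) * y)\<^sup>2"
    by (simp add: P_def hpoly_def algebra_simps power2_eq_square)
  moreover have "(sqrt 2 * x - (2 + sqrt 2) * y)\<^sup>2 \<ge> 0" by simp
  ultimately have "P \<le> 1" "- 1 \<le> P" using xy(1) by linarith+
  then show ?thesis by (simp add: P_def)
qed

text \<open>Reversing the inequality needs only a lower bound for the modulus, at \<open>\<theta> = \<pi>/4\<close>, and an upper
  bound for the norm of the extremal polynomial; evaluation at \<open>\<theta> = 0\<close> makes that norm exactly one.\<close>

lemma sup_norm_extremal:
  assumes "\<bar>\<sigma>\<bar> = 1"
  defines "P \<equiv> hpoly \<sigma> (\<sigma> * (5 + 4 * sqrt 2)) (\<sigma> * - (4 + 4 * sqrt 2))"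
  shows "sup_norm (arc (pi / 4)) P = 1" "sup_norm (arc (pi / 4)) (modulus P) = 5 + 4 * sqrt 2"
proof -
  have "P z = \<sigma> * hpoly 1 (5 + 4 * sqrt 2) (- (4 + 4 * sqrt 2)) z" for z
    by (cases z) (simp add: P_def hpoly_def algebra_simps)
  then have "\<bar>P (x, y)\<bar> \<le> 1" if "(x, y) \<in> arc (pi / 4)" for x y
    using abs_extremal_le_1[OF that] assms(1) by (simp add: abs_mult)
  then have "sup_norm (arc (pi / 4)) P \<le> 1"
    using arc_quarter_pi_points(1) by (intro sup_norm_le) auto
  moreover have "1 \<le> sup_norm (arc (pi / 4)) P"
    using coefficient_bounds(1)[where a = \<sigma>] assms(1)
    unfolding P_def by metis
  ultimately show norm: "sup_norm (arc (pi / 4)) P = 1" by simp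
  have mod: "modulus P = hpoly 1 (5 + 4 * sqrt 2) (4 + 4 * sqrt 2)"
    unfolding P_def modulus_hpoly abs_mult assms(1) abs_minus_cancel by simp
  have "hpoly 1 (5 + 4 * sqrt 2) (4 + 4 * sqrt 2) (sqrt 2 / 2, sqrt 2 / 2) = 5 + 4 * sqrt 2"
    by (simp add: hpoly_def power2_eq_square field_simps)
  then have "5 + 4 * sqrt 2 \<le> sup_norm (arc (pi / 4)) (modulus P)"
    using abs_hpoly_le_sup_norm[OF arc_quarter_pi_points(3), of 1 "5 + 4 * sqrt 2" "4 + 4 * sqrt 2"]
    unfolding mod by linarith
  moreover have "P \<in> hpolys" by (auto simp: P_def hpolys_def)
  then have "sup_norm (arc (pi / 4)) (modulus P) \<le> 5 + 4 * sqrt 2"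
    using sup_norm_modulus_le norm by fastforce
  ultimately show "sup_norm (arc (pi / 4)) (modulus P) = 5 + 4 * sqrt 2" by simp
qed

theorem theorem4p1:
  "is_unconditional_constant (arc (pi / 4)) (5 + 4 * sqrt 2)
   \<and> (\<forall>P\<in>hpolys.
        sup_norm (arc (pi / 4)) (modulus P) \<le> (5 + 4 * sqrt 2) * sup_norm (arc (pi / 4)) P)
   \<and> (\<forall>P\<in>{\<lambda>(x, y). x\<^sup>2 + (5 + 4 * sqrt 2) * y\<^sup>2 - (4 + 4 * sqrt 2) * x * y,
            \<lambda>(x, y). - (x\<^sup>2 + (5 + 4 * sqrt 2) * y\<^sup>2 - (4 + 4 * sqrt 2) * x * y)}.
        P \<in> hpolys \<and>
        sup_norm (arc (pi / 4)) (modulus P) = (5 + 4 * sqrt 2) * sup_norm (arc (pi / 4)) P)"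
proof -
  define E where "E \<sigma> = hpoly \<sigma> (\<sigma> * (5 + 4 * sqrt 2)) (\<sigma> * - (4 + 4 * sqrt 2))" for \<sigma>
  have E_hpolys: "E \<sigma> \<in> hpolys" for \<sigma> by (auto simp: E_def hpolys_def)
  have E: "sup_norm (arc (pi / 4)) (E \<sigma>) = 1"
    "sup_norm (arc (pi / 4)) (modulus (E \<sigma>)) = 5 + 4 * sqrt 2" if "\<bar>\<sigma>\<bar> = 1" for \<sigma>
    using sup_norm_extremal[OF that] by (simp_all only: E_def)
  have plus: "(\<lambda>(x, y). x\<^sup>2 + (5 + 4 * sqrt 2) * y\<^sup>2 - (4 + 4 * sqrt 2) * x * y) = E 1"
    by (auto simp: fun_eq_iff E_def hpoly_def algebra_simps)
  have minus: "(\<lambda>(x, y). - (x\<^sup>2 + (5 + 4 * sqrt 2) * y\<^sup>2 - (4 + 4 * sqrt 2) * x * y)) = E (- 1)"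
    by (auto simp: fun_eq_iff E_def hpoly_def algebra_simps)
  have "unconditional_bound (arc (pi / 4)) (5 + 4 * sqrt 2)"
    unfolding unconditional_bound_def using sup_norm_modulus_le by (auto intro: add_pos_nonneg)
  moreover have "5 + 4 * sqrt 2 \<le> C" if "unconditional_bound (arc (pi / 4)) C" for C
    using that E_hpolys[of 1] E[of 1] unfolding unconditional_bound_def by fastforce
  ultimately show ?thesis
    unfolding plus minus is_unconditional_constant_def
    using sup_norm_modulus_le E_hpolys E by simp
qed

end
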